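(* Let $\mu$ and $\lambda$ be uncountable cardinals such that: (a) $\omega_1\le\mu\le\mathfrak c\le\lambda\le 2^{\mathfrak c}$, $\lambda^{<\mu}\le\lambda$, and $\operatorname{cf}(\lambda)\ge\mu$; and (b) for every infinite cardinal $\kappa<\mu$ and every $Y\in[\omega^*]^{<\lambda}$, every sequence in $(\beta\omega\setminus Y)^\kappa$ has an accumulation point in $(\beta\omega\setminus Y)^\kappa$. Then there exists $X\subseteq\beta\omega$ with $\omega\subseteq X$ and $|X|=\lambda$ such that $X^\kappa$ is countably compact for every $\kappa<\mu$, but $\operatorname{CL}(X)$ is not pseudocompact.
   Context: $\beta\omega$ is the Stone–Čech compactification of the discrete space $\omega$ (the space of ultrafilters on $\omega$), $\omega^*=\beta\omega\setminus\omega$, and $[\omega^*]^{<\lambda}$ denotes the family of subsets of $\omega^*$ of cardinality less than $\lambda$. $\lambda^{<\mu}=\sup\{\lambda^\kappa:\kappa<\mu\}$. Powers carry the product topology. For a space $Y$, $\operatorname{CL}(Y)$ is the set of nonempty closed subsets of $Y$ with the Vietoris topology (generated by $A^+=\{F:F\subseteq A\}$ and $A^-=\{F:F\cap A\ne\emptyset\}$, $A\subseteq Y$ open). A space is pseudocompact if every continuous real-valued function on it is bounded. *)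

theory Defs
  imports "HOL-Analysis.Analysis"
begin

unbundle cardinal_syntax

text \<open>Points of the Stone-Cech compactification of the discrete space omega are the
ultrafilters on nat, represented as families of sets of naturals.\<close>

definition ultrafilter_nat :: "nat set set \<Rightarrow> bool" where
  "ultrafilter_nat U \<longleftrightarrow>
     {} \<notin> U \<and> UNIV \<in> U \<and>
     (\<forall>A B. A \<in> U \<and> A \<subseteq> B \<longrightarrow> B \<in> U) \<and>
     (\<forall>A B. A \<in> U \<and> B \<in> U \<longrightarrow> A \<inter> B \<in> U) \<and>
     (\<forall>A. A \<in> U \<or> - A \<in> U)"

definition beta_omega :: "nat set set set" where
  "beta_omega = {U. ultrafilter_nat U}"

definition principal_uf :: "nat \<Rightarrow> nat set set" where
  "principal_uf n = {A. n \<in> A}"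

definition omega_pts :: "nat set set set" where
  "omega_pts = range principal_uf"

definition omega_star :: "nat set set set" where
  "omega_star = beta_omega - omega_pts"

definition beta_omega_top :: "nat set set topology" where
  "beta_omega_top = topology_generated_by {{U \<in> beta_omega. A \<in> U} | A. True}"

definition seq_acc_point :: "'a topology \<Rightarrow> (nat \<Rightarrow> 'a) \<Rightarrow> 'a \<Rightarrow> bool" where
  "seq_acc_point T s p \<longleftrightarrow> p \<in> topspace T \<and>
     (\<forall>U. openin T U \<and> p \<in> U \<longrightarrow> infinite {n. s n \<in> U})"

definition countably_compact_space :: "'a topology \<Rightarrow> bool" where
  "countably_compact_space T \<longleftrightarrow>
     (\<forall>\<U>. countable \<U> \<and> (\<forall>U \<in> \<U>. openin T U) \<and> topspace T \<subseteq> \<Union>\<U>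
        \<longrightarrow> (\<exists>\<F>. finite \<F> \<and> \<F> \<subseteq> \<U> \<and> topspace T \<subseteq> \<Union>\<F>))"

definition pseudocompact :: "'a topology \<Rightarrow> bool" where
  "pseudocompact T \<longleftrightarrow>
     (\<forall>f. continuous_map T euclideanreal f \<longrightarrow> (\<exists>B. \<forall>x \<in> topspace T. \<bar>f x\<bar> \<le> B))"

definition CL_set :: "'a topology \<Rightarrow> 'a set set" where
  "CL_set T = {F. closedin T F \<and> F \<noteq> {}}"

definition vietoris :: "'a topology \<Rightarrow> 'a set topology" where
  "vietoris T = topology_generated_by
     ({{F \<in> CL_set T. F \<subseteq> A} | A. openin T A} \<union>
      {{F \<in> CL_set T. F \<inter> A \<noteq> {}} | A. openin T A})"

end

theory Submission
  imports Defs
begin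

text \<open>
  Let \<open>F\<^sub>n\<close> be the \<open>n\<close>-th level of the binary tree, coded in the naturals. The
  finite sets \<open>F\<^sub>n\<close> of principal ultrafilters are isolated points of \<open>CL(X)\<close>, so it suffices that
  they do not accumulate. If a closed set \<open>G\<close> consists of free ultrafilters with the same image
  \<open>p\<close> under the level map and the limit along \<open>p\<close> of some branch \<open>b\<close> of the tree is not in \<open>X\<close>,
  then the complement of \<open>b\<close> is a neighbourhood of \<open>G\<close> that contains no \<open>F\<^sub>n\<close>. All other \<open>G\<close>
  are easily separated from the \<open>F\<^sub>n\<close>.

  Hence \<open>X\<close> only has to omit, for each \<open>p\<close>, the limit of one branch. We build \<open>X\<close> in \<open>\<lambda>\<close> stages.
  Each stage adds fewer than \<open>\<mu>\<close> points: the coordinates of an accumulation point of a sequence in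
  a power of what has been built so far, and one further point, so that \<open>X\<close> gets \<open>\<lambda>\<close> elements.
  Distinct branches have distinct limits along a free \<open>p\<close>, so there are continuum many limits, and
  when \<open>p\<close> first becomes relevant one of them can be banned forever. Fewer than \<open>\<lambda>\<close>
  points are banned at any stage, so the accumulation hypothesis keeps the construction going. As
  \<open>cf(\<lambda>) \<ge> \<mu>\<close>, every sequence in a power of \<open>X\<close> lives in some stage and is treated later.
\<close>

section \<open>Ultrafilters\<close>

text \<open>The value at \<open>U\<close> of the continuous extension of \<open>h\<close> to
  \<beta>\<omega>, that is, the limit of \<open>h\<close> along \<open>U\<close>.\<close>

definition push :: "(nat \<Rightarrow> nat) \<Rightarrow> nat set set \<Rightarrow> nat set set" where
  "push h U = {A. h -` A \<in> U}"

lemma ultrafilter_nat_push: "ultrafilter_nat U \<Longrightarrow> ultrafilter_nat (push h U)"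
  unfolding ultrafilter_nat_def push_def mem_Collect_eq vimage_empty vimage_UNIV vimage_Int vimage_Compl
  by (meson vimage_mono)

lemma push_push: "push g (push h U) = push (g \<circ> h) U"
  by (auto simp: push_def vimage_comp)

lemma push_id [simp]: "push id U = U"
  by (simp add: push_def)

lemma push_principal: "push h (principal_uf n) = principal_uf (h n)"
  by (auto simp: push_def principal_uf_def)

lemma ultrafilter_nat_principal: "ultrafilter_nat (principal_uf n)"
  by (auto simp: ultrafilter_nat_def principal_uf_def)

lemma omega_pts_subset: "omega_pts \<subseteq> beta_omega"
  by (auto simp: omega_pts_def beta_omega_def ultrafilter_nat_principal)

lemma principal_uf_inj [simp]: "principal_uf m = principal_uf n \<longleftrightarrow> m = n"
proof
  assume "principal_uf m = principal_uf n"
  moreover have "{m} \<in> principal_uf m" by (simp add: principal_uf_def)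
  ultimately show "m = n" by (simp add: principal_uf_def)
qed simp

lemma ultrafilter_nat_Compl_iff: "ultrafilter_nat U \<Longrightarrow> - A \<in> U \<longleftrightarrow> A \<notin> U"
  unfolding ultrafilter_nat_def by (metis Compl_disjoint)

lemma ultrafilter_nat_mono: "ultrafilter_nat U \<Longrightarrow> A \<in> U \<Longrightarrow> A \<subseteq> B \<Longrightarrow> B \<in> U"
  unfolding ultrafilter_nat_def by blast

lemma ultrafilter_nat_Int: "ultrafilter_nat U \<Longrightarrow> A \<in> U \<Longrightarrow> B \<in> U \<Longrightarrow> A \<inter> B \<in> U"
  unfolding ultrafilter_nat_def by blast

lemma ultrafilter_nat_empty: "ultrafilter_nat U \<Longrightarrow> {} \<notin> U"
  unfolding ultrafilter_nat_def by blast

lemma ultrafilter_nat_subset_eq: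
  assumes "ultrafilter_nat U" "ultrafilter_nat V" "U \<subseteq> V"
  shows "U = V"
  using assms ultrafilter_nat_Compl_iff by blast

lemma ultrafilter_nat_singleton:
  assumes "ultrafilter_nat U" "{n} \<in> U"
  shows "U = principal_uf n"
proof -
  have "principal_uf n \<subseteq> U"
    using ultrafilter_nat_mono[OF assms] by (auto simp: principal_uf_def)
  then show ?thesis
    using ultrafilter_nat_subset_eq[OF ultrafilter_nat_principal assms(1)] by blast
qed

lemma ultrafilter_nat_finite:
  assumes "finite A" "ultrafilter_nat U" "A \<in> U"
  shows "\<exists>a\<in>A. U = principal_uf a"
  using assms
proof (induction A)
  case empty
  then show ?case by (simp add: ultrafilter_nat_empty)
next
  case (insert a A)
  show ?case
  proof (cases "A \<in> U")
    case False
    then have "insert a A \<inter> - A \<in> U"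
      using insert.prems ultrafilter_nat_Compl_iff ultrafilter_nat_Int by blast
    then have "{a} \<in> U"
      using ultrafilter_nat_mono[OF insert.prems(1)] by blast
    then show ?thesis
      using insert.prems(1) ultrafilter_nat_singleton by blast
  qed (use insert in blast)
qed

text \<open>The fibre over \<open>n\<close> belongs to \<open>U\<close>, and an ultrafilter with a
  finite member is principal.\<close>

lemma principal_if_push_principal:
  assumes "ultrafilter_nat U" "finite (h -` {n})" "push h U = principal_uf n"
  shows "U \<in> omega_pts"
proof -
  have "h -` {n} \<in> U"
    using assms(3) by (auto simp: push_def principal_uf_def set_eq_iff)
  then show ?thesis
    using ultrafilter_nat_finite[OF assms(2,1)] by (auto simp: omega_pts_def)
qed


text \<open>Both maps are sections of \<open>k\<close>, so \<open>h m = g n\<close> forces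
  \<open>m = n\<close>. The set \<open>?B\<close> where they differ lies in \<open>U\<close>, yet
  the image of \<open>?B\<close> under \<open>g\<close> has empty preimage under
  \<open>h\<close>.\<close>

lemma push_section_neq:
  assumes "ultrafilter_nat U" "U \<notin> omega_pts" "finite {n. g n = h n}"
    and "k \<circ> g = id" "k \<circ> h = id"
  shows "push g U \<noteq> push h U"
proof
  assume eq: "push g U = push h U"
  let ?B = "{n. g n \<noteq> h n}"
  have "- ?B \<notin> U"
    using assms(1-3) ultrafilter_nat_finite[of "- ?B" U] by (auto simp: omega_pts_def Compl_eq)
  then have "?B \<in> U"
    using assms(1) ultrafilter_nat_Compl_iff by blast
  then have "g -` (g ` ?B) \<in> U"
    by (rule ultrafilter_nat_mono[OF assms(1)]) auto
  then have "h -` (g ` ?B) \<in> U"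
    using eq by (auto simp: push_def)
  moreover have "h -` (g ` ?B) = {}"
  proof -
    have "h m = g n \<Longrightarrow> m = n" for m n
      using assms(4,5) by (metis comp_apply id_apply)
    then show ?thesis by fastforce
  qed
  ultimately show False
    using ultrafilter_nat_empty[OF assms(1)] by simp
qed

section \<open>Branches of the binary tree\<close>

text \<open>A positive number codes a node of the binary tree: the largest element of
  \<^term>\<open>set_decode m\<close> is the height of the node \<^term>\<open>m\<close>, and the smaller elements tell where
  the path leading to it turns right.\<close>

definition level :: "nat \<Rightarrow> nat" where
  "level m = Max (insert 0 (set_decode m))"

definition branch :: "nat set \<Rightarrow> nat \<Rightarrow> nat" where
  "branch b n = set_encode (insert n (b \<inter> {..<n}))"

lemma level_branch [simp]: "level (branch b n) = n"
  unfolding level_def branch_def by (subst set_encode_inverse) (auto intro!: Max_eqI)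

lemma level_comp_branch [simp]: "level \<circ> branch b = id"
  by (simp add: fun_eq_iff)

lemma finite_level_vimage [simp]: "finite (level -` {n})"
proof (rule finite_subset)
  show "level -` {n} \<subseteq> set_encode ` Pow {..n}"
  proof
    fix m assume "m \<in> level -` {n}"
    then have "set_decode m \<subseteq> {..n}"
      by (auto simp: level_def)
    then show "m \<in> set_encode ` Pow {..n}"
      by (metis Pow_iff image_eqI set_decode_inverse)
  qed
qed simp

text \<open>Two paths that differ at \<open>k\<close> share no node above height
  \<open>k\<close>.\<close>

lemma finite_branch_eq:
  assumes "b \<noteq> c"
  shows "finite {n. branch b n = branch c n}"
proof -
  obtain k where k: "k \<in> b \<longleftrightarrow> k \<notin> c"
    using assms by blast
  have "n \<le> k" if "branch b n = branch c n" for n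
  proof -
    have "insert n (b \<inter> {..<n}) = insert n (c \<inter> {..<n})"
      using that by (simp add: branch_def set_encode_eq)
    then have "k \<in> insert n (b \<inter> {..<n}) \<longleftrightarrow> k \<in> insert n (c \<inter> {..<n})"
      by simp
    with k show ?thesis
      by auto
  qed
  then show ?thesis
    by (auto intro: rev_finite_subset[of "{..k}"])
qed

text \<open>Distinct branches are sections of \<open>level\<close> that agree only finitely often.
  This yields continuum many limits along a free ultrafilter.\<close>

lemma inj_push_branch:
  assumes "ultrafilter_nat U" "U \<notin> omega_pts"
  shows "inj (\<lambda>b. push (branch b) U)"
  using push_section_neq[OF assms finite_branch_eq level_comp_branch level_comp_branch]
  by (meson injI)

lemma push_level_free:
  assumes "U \<in> omega_star"
  shows "push level U \<in> omega_star"
proof -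
  have U: "ultrafilter_nat U" "U \<notin> omega_pts"
    using assms by (auto simp: omega_star_def beta_omega_def)
  then have "push level U \<noteq> principal_uf n" for n
    using principal_if_push_principal[OF U(1) finite_level_vimage] by blast
  then show ?thesis
    using ultrafilter_nat_push[OF U(1), of level]
    by (simp add: omega_star_def omega_pts_def beta_omega_def image_iff)
qed

section \<open>The Vietoris hyperspace\<close>

lemma openin_beta_omega_basic: "openin beta_omega_top {U \<in> beta_omega. A \<in> U}"
  unfolding beta_omega_top_def by (rule topology_generated_by_Basis) blast

lemma topspace_beta_omega_top [simp]: "topspace beta_omega_top = beta_omega"
proof -
  have "{U \<in> beta_omega. UNIV \<in> U} = beta_omega"
    by (auto simp: beta_omega_def ultrafilter_nat_def)
  then show ?thesis
    unfolding beta_omega_top_def topology_generated_by_topspace by blast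
qed

lemma openin_vietoris_subset:
  "openin T A \<Longrightarrow> openin (vietoris T) {F \<in> CL_set T. F \<subseteq> A}"
  unfolding vietoris_def by (rule topology_generated_by_Basis) blast

lemma openin_vietoris_meets:
  "openin T A \<Longrightarrow> openin (vietoris T) {F \<in> CL_set T. F \<inter> A \<noteq> {}}"
  unfolding vietoris_def by (rule topology_generated_by_Basis) blast

lemma topspace_vietoris [simp]: "topspace (vietoris T) = CL_set T"
proof -
  have "CL_set T = {F \<in> CL_set T. F \<subseteq> topspace T}"
    by (auto simp: CL_set_def dest: closedin_subset)
  then show ?thesis
    unfolding vietoris_def topology_generated_by_topspace by blast
qed

text \<open>The function with value \<open>n\<close> at \<open>F n\<close> and 0 elsewhere is
  unbounded. It is continuous since the \<open>F n\<close> are isolated and \<open>nbhd\<close>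
  makes it locally zero at all other points.\<close>

lemma not_pseudocompact_if_isolated_sequence:
  assumes "inj F"
    and op: "\<And>n::nat. openin T {F n}"
    and nbhd: "\<And>x. x \<in> topspace T \<Longrightarrow> x \<notin> range F \<Longrightarrow> \<exists>N. openin T N \<and> x \<in> N \<and> N \<inter> range F = {}"
  shows "\<not> pseudocompact T"
proof
  define f where "f x = (if x \<in> range F then real (inv F x) else 0)" for x
  have fF: "f (F n) = real n" for n
    by (simp add: f_def assms(1))
  have top: "F n \<in> topspace T" for n
    using openin_subset[OF op[of n]] by simp
  have "continuous_map T euclideanreal f"
    unfolding continuous_map
  proof (intro conjI allI impI)
    fix V :: "real set"
    show "openin T {x \<in> topspace T. f x \<in> V}"
    proof (subst openin_subopen, safe)
      fix x assume x: "x \<in> topspace T" "f x \<in> V"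
      show "\<exists>N. openin T N \<and> x \<in> N \<and> N \<subseteq> {x \<in> topspace T. f x \<in> V}"
      proof (cases "x \<in> range F")
        case True
        then obtain n where "x = F n" by blast
        then show ?thesis
          using op[of n] x by blast
      next
        case False
        then obtain N where N: "openin T N" "x \<in> N" "N \<inter> range F = {}"
          using nbhd x by blast
        have "f y = f x" if "y \<in> N" for y
          using N(3) that False by (auto simp: f_def)
        then have "N \<subseteq> {x \<in> topspace T. f x \<in> V}"
          using x(2) openin_subset[OF N(1)] by (metis (mono_tags, lifting) mem_Collect_eq subset_eq)
        then show ?thesis
          using N by blast
      qed
    qed
  qed simp
  moreover assume "pseudocompact T"
  ultimately obtain B where B: "\<And>x. x \<in> topspace T \<Longrightarrow> \<bar>f x\<bar> \<le> B"
    unfolding pseudocompact_def by blast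
  obtain n where "B < real n"
    using reals_Archimedean2 by blast
  then show False
    using B[OF top[of n]] fF[of n] by simp
qed

lemma not_pseudocompact_vietoris:
  assumes X: "X \<subseteq> beta_omega" "omega_pts \<subseteq> X"
    and missing: "\<And>x. x \<in> X - omega_pts \<Longrightarrow> \<exists>b. push (branch b) (push level x) \<notin> X"
  shows "\<not> pseudocompact (vietoris (subtopology beta_omega_top X))"
proof (rule not_pseudocompact_if_isolated_sequence)
  let ?T = "subtopology beta_omega_top X"
  define F where "F n = principal_uf ` (level -` {n})" for n
  \<comment> \<open>The trace on \<open>X\<close> of a basic open set; by \<open>op\<close> and
    \<open>C_Compl\<close> it is clopen.\<close>
  define C where "C A = {x \<in> X. A \<in> x}" for A
  have uf: "ultrafilter_nat x" if "x \<in> X" for x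
    using that X by (auto simp: beta_omega_def)
  have topX: "topspace ?T = X"
    using X by auto
  have pX: "principal_uf n \<in> X" for n
    using X by (auto simp: omega_pts_def)
  have C_p [simp]: "principal_uf n \<in> C A \<longleftrightarrow> n \<in> A" for n A
    using pX by (auto simp: C_def principal_uf_def)
  have op: "openin ?T (C A)" for A
  proof -
    have "C A = {U \<in> beta_omega. A \<in> U} \<inter> X"
      using X by (auto simp: C_def)
    then show ?thesis
      using openin_beta_omega_basic openin_subtopology by blast
  qed
  have C_Compl: "X - C A = C (- A)" for A
    using uf ultrafilter_nat_Compl_iff by (auto simp: C_def)
  \<comment> \<open>A free ultrafilter contains no finite set, so only principal points contain a
    level. Hence \<open>F n\<close> is clopen.\<close>
  have FC: "F n = C (level -` {n})" for n
  proof
    show "F n \<subseteq> C (level -` {n})"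
      by (auto simp: F_def)
    show "C (level -` {n}) \<subseteq> F n"
      using ultrafilter_nat_finite[OF finite_level_vimage] uf by (fastforce simp: C_def F_def)
  qed
  have C1: "C {k} = {principal_uf k}" for k
    using ultrafilter_nat_singleton uf pX by (auto simp: C_def principal_uf_def)
  have mem_F: "principal_uf k \<in> F n \<longleftrightarrow> level k = n" for k n
    by (auto simp: F_def)
  have ne: "branch {} n \<in> level -` {n}" for n
    by simp
  have F_CL: "F n \<in> CL_set ?T" for n
  proof -
    have "closedin ?T (F n)"
      unfolding closedin_def using op[of "- level -` {n}"] C_Compl topX
      by (auto simp: FC C_def)
    moreover have "F n \<noteq> {}"
      using ne[of n] unfolding F_def by blast
    ultimately show ?thesis
      by (simp add: CL_set_def)
  qed
  show "inj F"
  proof (rule injI)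
    fix m n assume "F m = F n"
    then show "m = n"
      using mem_F[of "branch {} m" m] mem_F[of "branch {} m" n] by simp
  qed
  show "openin (vietoris ?T) {F n}" for n
  proof -
    have ne': "level -` {n} \<noteq> {}"
      using ne by blast
    \<comment> \<open>A subset of \<open>F n\<close> that meets every singleton of
      \<open>F n\<close> is \<open>F n\<close> itself.\<close>
    let ?W = "{G \<in> CL_set ?T. G \<subseteq> F n} \<inter> (\<Inter>k\<in>level -` {n}. {G \<in> CL_set ?T. G \<inter> C {k} \<noteq> {}})"
    have "openin (vietoris ?T) ?W"
    proof (intro openin_Int)
      show "openin (vietoris ?T) {G \<in> CL_set ?T. G \<subseteq> F n}"
        unfolding FC by (intro openin_vietoris_subset op)
      show "openin (vietoris ?T) (\<Inter>k\<in>level -` {n}. {G \<in> CL_set ?T. G \<inter> C {k} \<noteq> {}})"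
        using ne' by (intro openin_Inter) (auto intro: op openin_vietoris_meets)
    qed
    moreover have "?W = {F n}"
      using F_CL by (auto simp: C1 F_def)
    ultimately show ?thesis by simp
  qed
  show "\<exists>N. openin (vietoris ?T) N \<and> G \<in> N \<and> N \<inter> range F = {}"
    if G: "G \<in> topspace (vietoris ?T)" "G \<notin> range F" for G
  proof -
    have GCL: "G \<in> CL_set ?T" and GX: "G \<subseteq> X" and "G \<noteq> {}"
      using G closedin_subset[of ?T G] topX by (auto simp: CL_set_def)
    then obtain x where x: "x \<in> G" by blast
    consider (principal) m where "principal_uf m \<in> G"
      | (free) "G \<inter> omega_pts = {}"
      by (auto simp: omega_pts_def)
    then show ?thesis
    proof cases
      case principal
      \<comment> \<open>\<open>F n\<close> belongs to \<open>?N\<close> only for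
        \<open>n = level m\<close>, so a single \<open>F n\<close> remains to be excluded by some
        \<open>N'\<close>.\<close>
      let ?N = "{H \<in> CL_set ?T. H \<inter> C {m} \<noteq> {}}"
      have N: "F n \<in> ?N \<longleftrightarrow> level m = n" for n
        using mem_F by (auto simp: C1 F_CL)
      have separate: ?thesis if "openin (vietoris ?T) N'" "G \<in> N'" "F (level m) \<notin> N'" for N'
      proof (intro exI[of _ "?N \<inter> N'"] conjI)
        show "openin (vietoris ?T) (?N \<inter> N')"
          by (intro openin_Int openin_vietoris_meets op that)
        show "G \<in> ?N \<inter> N'"
          using GCL principal that(2) by (auto simp: C1)
        show "?N \<inter> N' \<inter> range F = {}"
        proof (rule equals0I)
          fix H assume H: "H \<in> ?N \<inter> N' \<inter> range F"
          then obtain n where n: "H = F n" by blast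
          have "level m = n"
            using N[of n] IntD1[OF IntD1[OF H]] unfolding n by (rule iffD1)
          then show False
            using H n that(3) by simp
        qed
      qed
      have "G \<noteq> F (level m)"
        using G(2) by blast
      \<comment> \<open>An extra point of \<open>G\<close> is detected by meeting the complement of
        the level, a missing point \<open>y\<close> by staying inside the complement of
        \<open>y\<close>.\<close>
      then consider y where "y \<in> G" "y \<notin> F (level m)" | y where "y \<in> F (level m)" "y \<notin> G"
        by blast
      then show ?thesis
      proof cases
        case 1
        let ?A = "- level -` {level m}"
        have "y \<in> C ?A"
          using 1 GX C_Compl[of "level -` {level m}"] FC by blast
        moreover have "F (level m) \<inter> C ?A = {}"
          using C_Compl[of "level -` {level m}"] FC by blast
        ultimately show ?thesis
          using GCL 1(1) by (intro separate[OF openin_vietoris_meets[OF op[of ?A]]]) auto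
      next
        case 2
        then obtain k where k: "y = principal_uf k"
          by (auto simp: F_def)
        have C: "C (- {k}) = X - {y}"
          using C_Compl[of "{k}"] C1 k by simp
        show ?thesis
          using GCL GX 2 by (intro separate[OF openin_vietoris_subset[OF op[of "- {k}"]]]) (auto simp: C)
      qed
    next
      case free
      then obtain b where b: "push (branch b) (push level x) \<notin> X"
        using missing x GX by blast
      show ?thesis
      proof (cases "\<forall>z\<in>G. push level z = push level x")
        case False
        \<comment> \<open>The set \<open>A\<close> distinguishes the level images of
          \<open>x\<close> and \<open>z\<close>. No \<open>F n\<close> meets both sides, as its
          points lie on a single level.\<close>
        then obtain z A where z: "z \<in> G" "level -` A \<in> x" "level -` A \<notin> z"
          using ultrafilter_nat_subset_eq[OF ultrafilter_nat_push ultrafilter_nat_push] uf GX x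
          unfolding push_def by blast
        let ?N = "{H \<in> CL_set ?T. H \<inter> C (level -` A) \<noteq> {}} \<inter> {H \<in> CL_set ?T. H \<inter> C (- level -` A) \<noteq> {}}"
        have "openin (vietoris ?T) ?N"
          by (intro openin_Int openin_vietoris_meets op)
        moreover have "G \<in> ?N"
          using GCL GX x z C_Compl[of "level -` A"] by (auto simp: C_def)
        moreover have "?N \<inter> range F = {}"
          by (auto simp: F_def)
        ultimately show ?thesis by blast
      next
        case True
        let ?B = "range (branch b)"
        let ?N = "{H \<in> CL_set ?T. H \<subseteq> C (- ?B)}"
        \<comment> \<open>On \<open>?B\<close> the map \<open>branch b\<close> after
          \<open>level\<close> is the identity, so a point of \<open>G\<close> containing
          \<open>?B\<close> would be the excluded limit. In contrast, every \<open>F n\<close>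
          contains the point of the node \<open>branch b n\<close>.\<close>
        have "?B \<notin> z" if "z \<in> G" for z
        proof
          assume B: "?B \<in> z"
          have zu: "ultrafilter_nat z" using that GX uf by blast
          have "z \<subseteq> push (branch b) (push level z)"
          proof
            fix A assume "A \<in> z"
            with B zu have "A \<inter> ?B \<in> z" by (intro ultrafilter_nat_Int)
            moreover have "A \<inter> ?B \<subseteq> level -` (branch b -` A)" by auto
            ultimately show "A \<in> push (branch b) (push level z)"
              using ultrafilter_nat_mono[OF zu] by (simp add: push_def)
          qed
          then have "z = push (branch b) (push level z)"
            by (intro ultrafilter_nat_subset_eq ultrafilter_nat_push zu)
          then show False
            using b True that GX by auto
        qed
        then have "G \<in> ?N"
          using GCL GX C_Compl[of ?B] by (auto simp: C_def)
        moreover have "openin (vietoris ?T) ?N"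
          by (intro openin_vietoris_subset op)
        moreover have "F n \<notin> ?N" for n
          using mem_F[of "branch b n" n] C_p[of "branch b n" "- ?B"] by auto
        ultimately show ?thesis by blast
      qed
    qed
  qed
qed

section \<open>Accumulation points\<close>

lemma seq_acc_point_subtopology:
  assumes "seq_acc_point T s p" "p \<in> S" "\<And>n. s n \<in> S"
  shows "seq_acc_point (subtopology T S) s p"
  using assms unfolding seq_acc_point_def by (auto simp: openin_subtopology)

lemma seq_acc_point_continuous_map:
  assumes "seq_acc_point T s p" "continuous_map T T' f" "\<And>n. s n \<in> topspace T"
  shows "seq_acc_point T' (\<lambda>n. f (s n)) (f p)"
  unfolding seq_acc_point_def
proof (intro conjI allI impI)
  show "f p \<in> topspace T'"
    using assms(1,2) by (auto simp: seq_acc_point_def dest: continuous_map_image_subset_topspace)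
  fix U assume U: "openin T' U \<and> f p \<in> U"
  then have "openin T {x \<in> topspace T. f x \<in> U}"
    using assms(2) openin_continuous_map_preimage by blast
  then have "infinite {n. s n \<in> {x \<in> topspace T. f x \<in> U}}"
    using assms(1) U unfolding seq_acc_point_def by blast
  then show "infinite {n. f (s n) \<in> U}"
    using assms(3) by simp
qed

text \<open>Without a finite subcover, choose \<open>s n\<close> outside the first
  \<open>n + 1\<close> members of the cover. A member \<open>?u k\<close> around an accumulation
  point then contains \<open>s n\<close> only for \<open>n < k\<close>.\<close>

lemma countably_compact_if_seq_acc_point:
  assumes "\<And>s. (\<And>n. s n \<in> topspace T) \<Longrightarrow> \<exists>p. seq_acc_point T s p"
  shows "countably_compact_space T"
  unfolding countably_compact_space_def
proof (intro allI impI)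
  fix \<U> assume U: "countable \<U> \<and> (\<forall>U\<in>\<U>. openin T U) \<and> topspace T \<subseteq> \<Union>\<U>"
  show "\<exists>\<F>. finite \<F> \<and> \<F> \<subseteq> \<U> \<and> topspace T \<subseteq> \<Union>\<F>"
  proof (rule ccontr)
    assume "\<not> ?thesis"
    then have no: "\<not> topspace T \<subseteq> \<Union>\<F>" if "finite \<F>" "\<F> \<subseteq> \<U>" for \<F>
      using that by blast
    have "\<U> \<noteq> {}"
      using no[of "{}"] U by auto
    let ?u = "from_nat_into \<U>"
    have u: "?u n \<in> \<U>" for n
      using \<open>\<U> \<noteq> {}\<close> by (rule from_nat_into)
    have "\<exists>x. x \<in> topspace T \<and> x \<notin> \<Union>(?u ` {..n})" for n
      using no[of "?u ` {..n}"] u by blast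
    then obtain s where s: "\<And>n. s n \<in> topspace T" "\<And>n. s n \<notin> \<Union>(?u ` {..n})"
      by metis
    obtain p where p: "seq_acc_point T s p"
      using assms s(1) by blast
    then have "p \<in> \<Union>\<U>"
      using U by (auto simp: seq_acc_point_def)
    then obtain k where k: "p \<in> ?u k"
      using U from_nat_into_surj by (metis UnionE)
    have "{n. s n \<in> ?u k} \<subseteq> {..<k}"
      using s(2) by (force simp: not_less[symmetric])
    moreover have "infinite {n. s n \<in> ?u k}"
      using p k U u unfolding seq_acc_point_def by blast
    ultimately show False
      using finite_subset by blast
  qed
qed

lemma seq_acc_point_product_subtopology:
  assumes "seq_acc_point (product_topology (\<lambda>i. subtopology (T i) (S i)) K) s p"
    and "\<And>n. s n \<in> topspace (product_topology (\<lambda>i. subtopology (T i) (S i)) K)"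
  shows "seq_acc_point (product_topology T K) s p"
proof -
  have "continuous_map (product_topology (\<lambda>i. subtopology (T i) (S i)) K) (product_topology T K) id"
    unfolding subtopology_product_topology[symmetric] by (intro continuous_map_from_subtopology) simp
  from seq_acc_point_continuous_map[OF assms(1) this assms(2)] show ?thesis
    by simp
qed

text \<open>A sequence in the smaller power is extended by repeating one coordinate \<open>k\<close>
  outside the image of \<open>h\<close>, and the accumulation point is carried back by the
  continuous map \<open>?f\<close>. The empty power, which has no such \<open>k\<close>, is a single
  point.\<close>

lemma seq_acc_point_power_transfer:
  assumes h: "inj_on h K" "h ` K \<subseteq> K'"
    and acc: "\<And>s. (\<And>n. s n \<in> topspace (product_topology (\<lambda>_. T) K')) \<Longrightarrow>
      \<exists>p. seq_acc_point (product_topology (\<lambda>_. T) K') s p"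
    and s: "\<And>n. s n \<in> topspace (product_topology (\<lambda>_. T) K)"
  shows "\<exists>p. seq_acc_point (product_topology (\<lambda>_. T) K) s p"
proof (cases "K = {}")
  case True
  with s have "s n = (\<lambda>_. undefined)" for n
    by simp
  then have "s = (\<lambda>_ _. undefined)" by auto
  then show ?thesis
    using True by (intro exI[of _ "\<lambda>_. undefined"]) (simp add: seq_acc_point_def)
next
  case False
  then obtain k where "k \<in> K" by blast
  define g where "g = inv_into K h"
  define s' where "s' n = (\<lambda>j\<in>K'. s n (if j \<in> h ` K then g j else k))" for n
  have g: "g (h i) = i" if "i \<in> K" for i
    using that h by (simp add: g_def)
  have top: "s' n \<in> topspace (product_topology (\<lambda>_. T) K')" for n
    using s[of n] \<open>k \<in> K\<close> g by (auto simp: s'_def PiE_iff)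
  then obtain p where p: "seq_acc_point (product_topology (\<lambda>_. T) K') s' p"
    using acc by blast
  let ?f = "\<lambda>x. \<lambda>i\<in>K. x (h i)"
  have "continuous_map (product_topology (\<lambda>_. T) K') (product_topology (\<lambda>_. T) K) ?f"
    using h by (auto simp: continuous_map_componentwise intro!: continuous_map_product_projection)
  from seq_acc_point_continuous_map[OF p this top]
  have "seq_acc_point (product_topology (\<lambda>_. T) K) (\<lambda>n. ?f (s' n)) (?f p)" .
  moreover have "?f (s' n) = s n" for n
  proof (rule extensionalityI[of _ K])
    show "s n \<in> extensional K"
      using s[of n] by (simp add: PiE_iff)
    show "?f (s' n) i = s n i" if "i \<in> K" for i
      using that h g by (auto simp: s'_def)
  qed simp
  ultimately show ?thesis by auto
qed

section \<open>Cardinal arithmetic\<close>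

lemma card_of_Times_ordLess_infinite:
  assumes "infinite A \<or> infinite B" "|A| <o |C|" "|B| <o |C|"
  shows "|A \<times> B| <o |C|"
proof -
  have *: "|X \<times> Y| \<le>o |Y| \<and> |Y \<times> X| \<le>o |Y|" if "|X| \<le>o |Y|" "infinite Y"
    for X :: "'x set" and Y :: "'y set"
    using that card_of_Times_ordLeq_infinite_Field[of "|Y|" X Y] card_of_Times_ordLeq_infinite_Field[of "|Y|" Y X]
    by (simp add: Field_card_of card_of_card_order_on card_of_mono1)
  show ?thesis
  proof (cases "|A| \<le>o |B|")
    case True
    then have "infinite B"
      using assms(1) card_of_ordLeq_infinite by blast
    then show ?thesis
      using * True assms(3) ordLeq_ordLess_trans by blast
  next
    case False
    then have le: "|B| \<le>o |A|"
      using not_ordLeq_iff_ordLess[OF card_of_Well_order card_of_Well_order] ordLess_imp_ordLeq by blast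
    then have "infinite A"
      using assms(1) card_of_ordLeq_infinite by blast
    then show ?thesis
      using * le assms(2) ordLeq_ordLess_trans by blast
  qed
qed

text \<open>A smaller well-order is isomorphic to a proper initial segment. Thus segments of
  \<open>M\<close> can replace arbitrary index sets of size below \<mu>, which keeps the number of
  index sets at most \<mu>.\<close>

lemma ordLess_card_of_underS:
  assumes "|A| <o |M|"
  shows "\<exists>m\<in>M. |A| \<le>o |underS |M| m|"
proof -
  obtain m where m: "m \<in> M" "|A| =o Restr |M| (underS |M| m)"
    using assms ordLess_iff_ordIso_Restr[OF card_of_Well_order card_of_Well_order, of A M]
    by (auto simp: Field_card_of)
  let ?r = "Restr |M| (underS |M| m)"
  have "Card_order ?r"
    using m(2) card_of_Card_order Card_order_ordIso2 by blast
  then have "|Field ?r| =o ?r"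
    by (rule card_of_Field_ordIso)
  then have "|A| =o |Field ?r|"
    using m(2) ordIso_symmetric ordIso_transitive by blast
  moreover have "|Field ?r| \<le>o |underS |M| m|"
    by (rule card_of_mono1) (auto simp: Field_def)
  ultimately show ?thesis
    using m(1) ordIso_ordLeq_trans by blast
qed

text \<open>If \<mu> < \<lambda>, the union has size at most that of \<open>J \<times> M\<close>,
  which is below \<lambda>. Otherwise \<lambda> = \<mu>, and the cofinality hypothesis makes
  \<lambda> regular.\<close>

lemma card_of_UN_ordLess_cofinality:
  fixes L :: "'a set"
  assumes "infinite M" "|M| \<le>o |L|"
    and cf: "\<And>A. A \<subseteq> L \<Longrightarrow> cofinal A |L| \<Longrightarrow> |M| \<le>o |A|"
    and J: "|J| <o |L|" and A: "\<And>j. j \<in> J \<Longrightarrow> |A j| <o |M|"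
  shows "|\<Union>j\<in>J. A j| <o |L|"
proof (cases "|M| <o |L|")
  case True
  have "|\<Union>j\<in>J. A j| \<le>o |SIGMA j : J. A j|"
    by (rule card_of_UNION_Sigma)
  also have "|SIGMA j : J. A j| \<le>o |J \<times> M|"
    using A ordLess_imp_ordLeq by (intro card_of_Sigma_mono1) blast
  also have "|J \<times> M| <o |L|"
    using card_of_Times_ordLess_infinite[of J M L] assms(1) J True by blast
  finally show ?thesis .
next
  case False
  then have LM: "|L| \<le>o |M|"
    using not_ordLess_iff_ordLeq[OF card_of_Well_order card_of_Well_order] by blast
  have "infinite L"
    using assms(1,2) card_of_ordLeq_infinite by blast
  have "|A| =o |L|" if "A \<subseteq> L" "cofinal A |L|" for A
    using card_of_mono1[OF that(1)] cf[OF that] LM ordIso_iff_ordLeq ordLeq_transitive by blast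
  then have "regularCard |L|"
    by (auto simp: regularCard_def Field_card_of)
  then have "stable |L|"
    using \<open>infinite L\<close> by (intro regularCard_stable) (auto simp: Field_card_of card_of_card_order_on)
  then show ?thesis
    using J A assms(2) ordLess_ordLeq_trans by (intro stable_UNION) blast+
qed

lemma bounded_if_card_less_cofinality:
  assumes "A \<subseteq> L" "|A| <o |M|"
    and cf: "\<And>A. A \<subseteq> L \<Longrightarrow> cofinal A |L| \<Longrightarrow> |M| \<le>o |A|"
  shows "\<exists>a\<in>L. \<forall>b\<in>A. (b, a) \<in> |L|"
proof -
  have "\<not> cofinal A |L|"
    using assms(2) cf[OF assms(1)] not_ordLess_ordLeq by blast
  then obtain a where a: "a \<in> L" "\<And>b. b \<in> A \<Longrightarrow> a = b \<or> (a, b) \<notin> |L|"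
    by (auto simp: cofinal_def Field_card_of)
  have "total_on L |L|" "refl_on L |L|"
    using card_of_well_order_on[of L] by (auto simp: order_on_defs)
  then have "(b, a) \<in> |L|" if "b \<in> A" for b
    using a that assms(1) unfolding total_on_def refl_on_def by (metis subsetD)
  then show ?thesis
    using a(1) by blast
qed

lemma card_of_PiE_mono:
  assumes "|I| \<le>o |L|" "|A| =o |B|" "L \<noteq> {}"
  shows "|PiE A (\<lambda>_. I)| \<le>o |PiE B (\<lambda>_. L)|"
proof -
  have eq: "PiE X (\<lambda>_. Y) = Func X Y" for X Y
    by (auto simp: PiE_iff Func_def extensional_def)
  have "|I| ^c |A| \<le>o |L| ^c |B|"
  proof (rule cexp_mono'[OF assms(1) ordIso_imp_ordLeq[OF assms(2)]])
    assume "Field |A| = {}"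
    then have "B = {}"
      using card_of_ordIso[of A B] assms(2) by (auto simp: Field_card_of bij_betw_def)
    then show "Field |B| = {}"
      by (simp add: Field_card_of)
  qed
  then show ?thesis
    by (simp add: eq cexp_def Field_card_of)
qed

section \<open>The construction\<close>

lemma finite_ordLess_infinite_sets: "finite A \<Longrightarrow> infinite B \<Longrightarrow> |A| <o |B|"
  using card_of_ordLeq_finite not_ordLeq_iff_ordLess[OF card_of_Well_order card_of_Well_order] by blast

lemma infinite_real_image_nat: "infinite (real ` UNIV)"
  by (simp add: range_inj_infinite inj_of_nat)

text \<open>The case \<open>a \<notin> A\<close>, with an empty segment, matters because stages and
  scheduled tasks are not confined to \<open>L\<close> and \<open>M\<close>.\<close>

lemma card_of_underS_ordLess: "infinite A \<Longrightarrow> |underS |A| a| <o |A|"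
proof (cases "a \<in> A")
  case True
  then show ?thesis
    using card_of_underS[of "|A|" a] by (simp add: Field_card_of card_of_card_order_on)
next
  case False
  then have "underS |A| a = {}"
    using FieldI2[of _ a "|A|"] by (auto simp: underS_def Field_card_of)
  then show "infinite A \<Longrightarrow> ?thesis"
    using finite_ordLess_infinite_sets[of "{}" A] by simp
qed

text \<open>By \<open>inj_push_branch\<close> there are continuum many limits along
  \<open>p\<close>, too many to lie in \<open>R\<close>.\<close>

lemma exists_branch_avoiding:
  assumes "p \<in> omega_star" "|R| <o |UNIV :: real set|"
  shows "\<exists>y. y \<notin> R \<and> (\<exists>b. y = push (branch b) p)"
proof (rule ccontr)
  assume "\<not> ?thesis"
  then have sub: "range (\<lambda>b. push (branch b) p) \<subseteq> R" by blast
  have p: "ultrafilter_nat p" "p \<notin> omega_pts"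
    using assms(1) by (auto simp: omega_star_def beta_omega_def)
  obtain f :: "real \<Rightarrow> nat set" where "inj f"
    using nat_sets_eqpoll_reals by (metis bij_betw_def eqpoll_def eqpoll_sym)
  then have "|UNIV :: real set| \<le>o |UNIV :: nat set set|"
    by (intro card_of_ordLeqI[of f]) auto
  also have "|UNIV :: nat set set| \<le>o |R|"
    using sub inj_push_branch[OF p] by (intro card_of_ordLeqI[of "\<lambda>b. push (branch b) p"]) auto
  finally show False
    using assms(2) not_ordLess_ordLeq by blast
qed

text \<open>The choice depends on \<open>R\<close> and \<open>p\<close> alone, so all later stages
  refer to the same point.\<close>

definition avoid :: "nat set set set \<Rightarrow> nat set set \<Rightarrow> nat set set" where
  "avoid R p = (SOME y. y \<notin> R \<and> (\<exists>b. y = push (branch b) p))"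

lemma avoid:
  assumes "p \<in> omega_star" "|R| <o |UNIV :: real set|"
  shows "avoid R p \<notin> R" "\<exists>b. avoid R p = push (branch b) p"
  using someI_ex[OF exists_branch_avoiding[OF assms]] by (auto simp: avoid_def)

text \<open>An injection of \<open>L \<times> T\<close> into \<open>L\<close> gives each task as
  many positions as \<open>L\<close> has elements. They cannot all lie at or below \<open>a\<close>,
  since that segment is smaller than \<open>L\<close>.\<close>

lemma unbounded_enumeration:
  assumes "infinite L" "|T| \<le>o |L|"
  shows "\<exists>e. \<forall>\<tau>\<in>T. \<forall>a\<in>L. \<exists>a'\<in>L. a \<in> underS |L| a' \<and> e a' = \<tau>"
proof -
  have "|L \<times> T| \<le>o |L|"
    using card_of_Times_ordLeq_infinite_Field[of "|L|" L T] assms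
    by (simp add: Field_card_of card_of_card_order_on card_of_mono1)
  then obtain j where j: "inj_on j (L \<times> T)" "j ` (L \<times> T) \<subseteq> L"
    using card_of_ordLeq[of "L \<times> T" L] by blast
  define e where "e a = snd (inv_into (L \<times> T) j a)" for a
  have "\<exists>a'\<in>L. a \<in> underS |L| a' \<and> e a' = \<tau>" if "\<tau> \<in> T" "a \<in> L" for \<tau> a
  proof (rule ccontr)
    assume no: "\<not> ?thesis"
    have wo: "total_on L |L|" "refl_on L |L|"
      using card_of_well_order_on[of L] by (auto simp: order_on_defs)
    have "j (c, \<tau>) \<in> insert a (underS |L| a)" if "c \<in> L" for c
    proof -
      have jc: "j (c, \<tau>) \<in> L" "e (j (c, \<tau>)) = \<tau>"
        using j \<open>\<tau> \<in> T\<close> that by (auto simp: e_def)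
      then have "a \<notin> underS |L| (j (c, \<tau>))"
        using no by blast
      then show ?thesis
        using wo jc(1) \<open>a \<in> L\<close> by (auto simp: underS_def total_on_def)
    qed
    then have "|L| \<le>o |insert a (underS |L| a)|"
      using j(1) that by (intro card_of_ordLeqI[of "\<lambda>c. j (c, \<tau>)"]) (auto simp: inj_on_def)
    moreover have "|{a} \<union> underS |L| a| <o |L|"
      using assms(1) finite_ordLess_infinite_sets[of "{a}" L]
      by (intro card_of_Un_ordLess_infinite card_of_underS_ordLess) auto
    then have "|insert a (underS |L| a)| <o |L|"
      by (simp only: insert_is_Un[symmetric])
    ultimately show False
      using not_ordLess_ordLeq by blast
  qed
  then show ?thesis by blast
qed

definition built :: "'a set \<Rightarrow> ('a \<Rightarrow> real \<Rightarrow> nat set set) \<Rightarrow> 'a \<Rightarrow> nat set set set" where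
  "built L P a = omega_pts \<union> (\<Union>b\<in>underS |L| a. range (P b))"

text \<open>A point that is already built cannot be banned any more. Subtracting
  \<open>built\<close> leaves only free ultrafilters and keeps old sequences inside the complement
  of the banned set.\<close>

definition banned :: "'a set \<Rightarrow> ('a \<Rightarrow> real \<Rightarrow> nat set set) \<Rightarrow> 'a \<Rightarrow> nat set set set" where
  "banned L P a =
    (\<Union>b\<in>underS |L| a. (\<lambda>x. avoid (range (P b)) (push level x)) ` (range (P b) - omega_pts)) - built L P a"

text \<open>The index \<^term>\<open>Inl (b, i)\<close> names the \<^term>\<open>i\<close>-th point added at stage \<^term>\<open>b\<close>, and
  \<^term>\<open>Inr n\<close> names the \<^term>\<open>n\<close>-th principal ultrafilter. Indices rather than points let all
  sequences be enumerated along \<^term>\<open>L\<close> before the recursion starts.\<close>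

primrec point :: "('a \<Rightarrow> real \<Rightarrow> nat set set) \<Rightarrow> ('a \<times> real) + nat \<Rightarrow> nat set set" where
  "point P (Inl bi) = P (fst bi) (snd bi)"
| "point P (Inr n) = principal_uf n"

definition known :: "'a set \<Rightarrow> 'a \<Rightarrow> (('a \<times> real) + nat) set" where
  "known L a = (underS |L| a \<times> UNIV) <+> UNIV"

text \<open>A task \<^term>\<open>t\<close> that mentions a point not yet built is ignored; since every task is
  scheduled unboundedly often, it comes up again later.\<close>

definition solves :: "'a set \<Rightarrow> ('a \<Rightarrow> real \<Rightarrow> nat set set) \<Rightarrow> 'a \<Rightarrow> real set
    \<Rightarrow> (nat \<times> real \<Rightarrow> ('a \<times> real) + nat) \<Rightarrow> (real \<Rightarrow> nat set set) \<Rightarrow> bool" where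
  "solves L P a K t R \<longleftrightarrow>
    (infinite K \<and> (\<forall>n. \<forall>k\<in>K. t (n, k) \<in> known L a) \<longrightarrow>
      seq_acc_point (product_topology (\<lambda>_. beta_omega_top) K)
        (\<lambda>n. \<lambda>k\<in>K. point P (t (n, k))) (restrict R K))"

text \<open>The bound on the range makes \<open>avoid\<close> applicable and keeps later banned sets
  smaller than \<lambda>. The demand for a point outside \<open>built\<close> makes \<open>X\<close>
  large enough.\<close>

definition stage :: "real set \<Rightarrow> 'a set \<Rightarrow> ('a \<Rightarrow> real \<times> (nat \<times> real \<Rightarrow> ('a \<times> real) + nat))
    \<Rightarrow> ('a \<Rightarrow> real \<Rightarrow> nat set set) \<Rightarrow> 'a \<Rightarrow> (real \<Rightarrow> nat set set) \<Rightarrow> bool" where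
  "stage M L e P a R \<longleftrightarrow>
    range R \<subseteq> beta_omega - banned L P a \<and> |range R| <o |M| \<and> \<not> range R \<subseteq> built L P a \<and>
    solves L P a (underS |M| (fst (e a))) (snd (e a)) R"

text \<open>Well-founded recursion requires that a stage depends on earlier stages only.\<close>

lemma stage_cong:
  assumes "\<And>b. b \<in> underS |L| a \<Longrightarrow> P b = Q b"
  shows "stage M L e P a R = stage M L e Q a R"
proof -
  have 1: "built L P a = built L Q a" "banned L P a = banned L Q a"
    using assms by (auto simp: built_def banned_def)
  have "point P i = point Q i" if "i \<in> known L a" for i
    using that assms by (auto simp: known_def)
  then have "(\<lambda>n. \<lambda>k\<in>K. point P (t (n, k))) = (\<lambda>n. \<lambda>k\<in>K. point Q (t (n, k)))"
    if "\<forall>n. \<forall>k\<in>K. t (n, k) \<in> known L a" for K and t :: "nat \<times> real \<Rightarrow> _"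
    using that by (auto simp: fun_eq_iff restrict_def)
  then have "solves L P a K t R = solves L Q a K t R" for K t
    unfolding solves_def by (intro imp_cong) auto
  with 1 show ?thesis
    by (simp add: stage_def)
qed

lemma point_known: "i \<in> known L a \<Longrightarrow> point P i \<in> built L P a"
  by (fastforce simp: known_def built_def omega_pts_def)

section \<open>The hypotheses and a single stage of the recursion\<close>

locale accumulation =
  fixes M :: "real set" and L :: "'a set"
  assumes omega1_le_mu: "|UNIV :: nat set| <o |M|"
    and mu_le_c: "|M| \<le>o |UNIV :: real set|"
    and c_le_lambda: "|UNIV :: real set| \<le>o |L|"
    and lambda_pow_less_mu: "\<And>K :: real set. |K| <o |M| \<Longrightarrow> |PiE K (\<lambda>_. L)| \<le>o |L|"
    and cf_lambda: "\<And>A. A \<subseteq> L \<Longrightarrow> cofinal A |L| \<Longrightarrow> |M| \<le>o |A|"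
    and acc: "\<And>(K :: real set) Y s. infinite K \<Longrightarrow> |K| <o |M| \<Longrightarrow>
               Y \<subseteq> omega_star \<Longrightarrow> |Y| <o |L| \<Longrightarrow>
               (\<And>n. s n \<in> topspace (product_topology (\<lambda>i. subtopology beta_omega_top (beta_omega - Y)) K)) \<Longrightarrow>
               \<exists>p. seq_acc_point (product_topology (\<lambda>i. subtopology beta_omega_top (beta_omega - Y)) K) s p"
begin

lemma mu_le_lambda: "|M| \<le>o |L|"
  using mu_le_c c_le_lambda ordLeq_transitive by blast

lemma infinite_M: "infinite M"
  using omega1_le_mu card_of_ordLeq_infinite[OF ordLess_imp_ordLeq] by auto

lemma infinite_L: "infinite L"
  using mu_le_lambda infinite_M card_of_ordLeq_infinite by blast

lemmas card_underS_less = card_of_underS_ordLess[OF infinite_L]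

text \<open>An accumulation point of the sequence of all principal ultrafilters is free, and
  \<open>acc\<close> finds one outside \<open>Y\<close>. As \<open>acc\<close> speaks of infinite
  powers, the sequence is placed on the diagonal of a countable power and one coordinate is read
  off.\<close>

lemma new_free_point:
  assumes "Y \<subseteq> omega_star" "|Y| <o |L|"
  shows "\<exists>z. z \<in> omega_star - Y"
proof -
  let ?K = "real ` UNIV"
  let ?T = "subtopology beta_omega_top (beta_omega - Y)"
  let ?s = "\<lambda>n. \<lambda>k\<in>?K. principal_uf n"
  have pY: "principal_uf n \<in> beta_omega - Y" for n
    using assms(1) omega_pts_subset by (auto simp: omega_star_def omega_pts_def)
  then have s: "?s n \<in> topspace (product_topology (\<lambda>_. ?T) ?K)" for n
    by (auto simp: PiE_iff)
  have "|?K| <o |M|"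
    using card_of_image omega1_le_mu ordLeq_ordLess_trans by blast
  then obtain p where p: "seq_acc_point (product_topology (\<lambda>_. ?T) ?K) ?s p"
    using acc[of ?K Y ?s, OF infinite_real_image_nat _ assms s] by blast
  have "continuous_map (product_topology (\<lambda>_. ?T) ?K) ?T (\<lambda>x. x (real 0))"
    by (rule continuous_map_product_projection[of "real 0" ?K "\<lambda>_. ?T"]) blast
  from seq_acc_point_continuous_map[OF p this s]
  have q: "seq_acc_point ?T principal_uf (p (real 0))"
    by (simp only: restrict_apply' rangeI)
  then have "p (real 0) \<in> beta_omega - Y"
    by (simp add: seq_acc_point_def)
  moreover have "p (real 0) \<noteq> principal_uf m" for m
  proof
    assume m: "p (real 0) = principal_uf m"
    let ?U = "{U \<in> beta_omega. {m} \<in> U} \<inter> (beta_omega - Y)"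
    have "openin ?T ?U"
      using openin_beta_omega_basic openin_subtopology by blast
    moreover have "principal_uf m \<in> ?U"
      using pY[of m] by (simp add: principal_uf_def)
    ultimately have "infinite {n. principal_uf n \<in> ?U}"
      using q m unfolding seq_acc_point_def by metis
    moreover have "{n. principal_uf n \<in> ?U} \<subseteq> {m}"
      by (auto simp: principal_uf_def)
    ultimately show False
      using finite_subset by blast
  qed
  ultimately show ?thesis
    by (auto simp: omega_star_def omega_pts_def)
qed

text \<open>Fewer than \<lambda> points are banned, all of them free, so \<open>acc\<close> applies
  with the banned set as \<open>Y\<close>.\<close>

lemma stage_exists:
  assumes P: "\<And>b. b \<in> underS |L| a \<Longrightarrow> range (P b) \<subseteq> beta_omega \<and> |range (P b)| <o |M|"
  shows "\<exists>R. stage M L e P a R"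
proof -
  have UN: "|\<Union>b\<in>underS |L| a. A b| <o |L|" if "\<And>b. b \<in> underS |L| a \<Longrightarrow> |A b| <o |M|"
    for A :: "'a \<Rightarrow> nat set set set"
    using card_of_UN_ordLess_cofinality[OF infinite_M mu_le_lambda cf_lambda card_underS_less that] .
  have small: "|f ` (range (P b) - omega_pts)| <o |M|" if "b \<in> underS |L| a" for f :: "_ \<Rightarrow> nat set set" and b
  proof -
    have "|f ` (range (P b) - omega_pts)| \<le>o |range (P b)|"
      using card_of_image card_of_mono1 ordLeq_transitive by (metis Diff_subset)
    then show ?thesis
      using P[OF that] ordLeq_ordLess_trans by blast
  qed
  have built_beta: "built L P a \<subseteq> beta_omega"
    using P omega_pts_subset by (auto simp: built_def)
  have disj: "built L P a \<inter> banned L P a = {}"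
    by (auto simp: banned_def)
  have banned_star: "banned L P a \<subseteq> omega_star"
  proof
    fix y assume y: "y \<in> banned L P a"
    then obtain b x where bx: "b \<in> underS |L| a" "x \<in> range (P b) - omega_pts"
      "y = avoid (range (P b)) (push level x)" "y \<notin> omega_pts"
      by (auto simp: banned_def built_def)
    have "push level x \<in> omega_star"
      using P[OF bx(1)] bx(2) by (intro push_level_free) (auto simp: omega_star_def)
    moreover have "|range (P b)| <o |UNIV :: real set|"
      using P[OF bx(1)] mu_le_c ordLess_ordLeq_trans by blast
    ultimately obtain c where "y = push (branch c) (push level x)"
      using avoid(2) bx(3) by blast
    then show "y \<in> omega_star"
      using \<open>push level x \<in> omega_star\<close> bx(4) ultrafilter_nat_push
      by (simp add: omega_star_def beta_omega_def)
  qed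
  have banned_small: "|banned L P a| <o |L|"
    unfolding banned_def by (rule ordLeq_ordLess_trans[OF card_of_mono1[OF Diff_subset] UN]) (rule small)
  \<comment> \<open>The free points built so far; a free \<open>z\<close> outside both sets is new
    and not banned.\<close>
  let ?Z = "(\<Union>b\<in>underS |L| a. range (P b) - omega_pts)"
  have "|?Z| <o |L|"
    using small[of _ id] by (intro UN) simp
  then have "|banned L P a \<union> ?Z| <o |L|"
    using infinite_L banned_small by (intro card_of_Un_ordLess_infinite)
  moreover have "banned L P a \<union> ?Z \<subseteq> omega_star"
  proof -
    have "range (P b) \<subseteq> beta_omega" if "b \<in> underS |L| a" for b
      using P[OF that] by blast
    then show ?thesis
      using banned_star unfolding omega_star_def by blast
  qed
  ultimately obtain z where z: "z \<in> omega_star - (banned L P a \<union> ?Z)"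
    using new_free_point by blast
  then have z': "z \<in> beta_omega - banned L P a" "z \<notin> built L P a"
    by (auto simp: omega_star_def built_def)
  define K where "K = underS |M| (fst (e a))"
  define t where "t = snd (e a)"
  show ?thesis
  proof (cases "infinite K \<and> (\<forall>n. \<forall>k\<in>K. t (n, k) \<in> known L a)")
    case False
    have "|range (\<lambda>_::real. z)| <o |M|"
      using infinite_M by (intro finite_ordLess_infinite_sets) auto
    then have "stage M L e P a (\<lambda>_. z)"
      using z' False unfolding stage_def solves_def K_def[symmetric] t_def[symmetric] by auto
    then show ?thesis by blast
  next
    case True
    let ?T = "\<lambda>_. subtopology beta_omega_top (beta_omega - banned L P a)"
    let ?s = "\<lambda>n. \<lambda>k\<in>K. point P (t (n, k))"
    have Kless: "|K| <o |M|"
      unfolding K_def by (rule card_of_underS_ordLess[OF infinite_M])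
    have s: "?s n \<in> topspace (product_topology ?T K)" for n
      using True point_known[of _ L a P] built_beta disj by (fastforce simp: PiE_iff)
    obtain p where p: "seq_acc_point (product_topology ?T K) ?s p"
      using acc[of K "banned L P a" ?s, OF _ Kless banned_star banned_small s] True by blast
    \<comment> \<open>The coordinates of the accumulation point, with the new point \<open>z\<close>
      as value off \<open>K\<close>.\<close>
    define R where "R k = (if k \<in> K then p k else z)" for k
    have pK: "p \<in> PiE K (\<lambda>_. beta_omega - banned L P a)"
      using p by (auto simp: seq_acc_point_def PiE_iff)
    then have rR: "restrict R K = p"
      by (auto simp: R_def fun_eq_iff restrict_def PiE_iff extensional_def)
    have "range R \<subseteq> insert z (p ` K)"
      by (auto simp: R_def)
    moreover have "|{z} \<union> p ` K| <o |M|"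
      using infinite_M finite_ordLess_infinite_sets[of "{z}" M] ordLeq_ordLess_trans[OF card_of_image Kless]
      by (intro card_of_Un_ordLess_infinite) auto
    ultimately have "|range R| <o |M|"
      using ordLeq_ordLess_trans[OF card_of_mono1] by auto
    moreover have "range R \<subseteq> beta_omega - banned L P a"
      using pK z' by (auto simp: R_def)
    moreover have "\<not> range R \<subseteq> built L P a"
    proof -
      \<comment> \<open>\<open>fst (e a)\<close> is not in its own strict segment, so
        \<open>R\<close> does take the value \<open>z\<close>.\<close>
      obtain k where "k \<notin> K"
        by (auto simp: K_def underS_def)
      then have "R k = z" by (simp add: R_def)
      then show ?thesis using z' by blast
    qed
    moreover have "solves L P a K t R"
      unfolding solves_def rR using seq_acc_point_product_subtopology[OF p s] by simp
    ultimately have "stage M L e P a R"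
      by (simp add: stage_def K_def t_def)
    then show ?thesis by blast
  qed
qed

section \<open>Counting the tasks\<close>

definition tasks :: "(real \<times> (nat \<times> real \<Rightarrow> ('a \<times> real) + nat)) set" where
  "tasks = (SIGMA m : M. PiE (UNIV \<times> underS |M| m) (\<lambda>_. (L \<times> UNIV) <+> UNIV))"

lemma card_nat_Times_less: "|K| <o |M| \<Longrightarrow> |(UNIV :: nat set) \<times> K| <o |M|"
  using omega1_le_mu by (intro card_of_Times_ordLess_infinite) auto

lemma card_index: "|(L \<times> (UNIV :: real set)) <+> (UNIV :: nat set)| \<le>o |L|"
proof -
  have "|L \<times> (UNIV :: real set)| \<le>o |L|"
    using card_of_Times_ordLeq_infinite_Field[of "|L|" L "UNIV :: real set"] infinite_L c_le_lambda
    by (simp add: Field_card_of card_of_card_order_on card_of_mono1)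
  moreover have "|UNIV :: nat set| \<le>o |L|"
    using infinite_L infinite_iff_card_of_nat by blast
  ultimately show ?thesis
    using card_of_Plus_ordLeq_infinite_Field[of "|L|"] infinite_L
    by (simp add: Field_card_of card_of_card_order_on)
qed

text \<open>There are at most \<lambda> segments, and each carries at most \<lambda> coded sequences
  because \<lambda>^{<\<mu>} \<le> \<lambda>.\<close>

lemma card_tasks: "|tasks| \<le>o |L|"
  unfolding tasks_def
proof (rule card_of_Sigma_ordLeq_infinite[OF infinite_L mu_le_lambda], rule ballI)
  fix m assume "m \<in> M"
  let ?A = "(UNIV :: nat set) \<times> underS |M| m"
  have less: "|?A| <o |M|"
    by (intro card_nat_Times_less card_of_underS_ordLess infinite_M)
  \<comment> \<open>\<open>lambda_pow_less_mu\<close> speaks of sets of reals, so the exponent is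
    replaced by a copy inside \<open>M\<close>.\<close>
  obtain K where K: "K \<subseteq> M" "|?A| =o |K|"
    using internalize_card_of_ordLeq2[THEN iffD1, OF ordLess_imp_ordLeq[OF less]] by blast
  then have "|K| <o |M|"
    using less ordIso_ordLess_trans ordIso_symmetric by blast
  have "|PiE ?A (\<lambda>_. (L \<times> (UNIV :: real set)) <+> (UNIV :: nat set))| \<le>o |PiE K (\<lambda>_. L)|"
    using card_index K(2) infinite_L by (intro card_of_PiE_mono) auto
  also have "|PiE K (\<lambda>_. L)| \<le>o |L|"
    by (rule lambda_pow_less_mu) fact
  finally show "|PiE ?A (\<lambda>_. (L \<times> (UNIV :: real set)) <+> (UNIV :: nat set))| \<le>o |L|" .
qed


section \<open>Properties of the finished space\<close>

context
  fixes e :: "'a \<Rightarrow> real \<times> (nat \<times> real \<Rightarrow> ('a \<times> real) + nat)" and P X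
  assumes e: "\<forall>\<tau>\<in>tasks. \<forall>a\<in>L. \<exists>a'\<in>L. a \<in> underS |L| a' \<and> e a' = \<tau>"
    and stage: "\<And>a. stage M L e P a (P a)"
    and X: "X = omega_pts \<union> (\<Union>a\<in>L. range (P a))"
begin

lemma X_subset: "X \<subseteq> beta_omega"
  using stage omega_pts_subset by (auto simp: X stage_def)

lemma strict_total_L:
  assumes "a \<in> L" "b \<in> L" "a \<noteq> b"
  shows "a \<in> underS |L| b \<or> b \<in> underS |L| a"
  using card_of_well_order_on[of L] assms
  by (auto simp: order_on_defs underS_def total_on_def)

lemma X_point:
  assumes "x \<in> X"
  shows "\<exists>i\<in>(L \<times> (UNIV :: real set)) <+> (UNIV :: nat set). x = point P i"
proof (cases "x \<in> omega_pts")
  case True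
  then obtain n where "x = point P (Inr n)"
    by (auto simp: omega_pts_def)
  then show ?thesis by blast
next
  case False
  then obtain a i where "a \<in> L" "x = point P (Inl (a, i))"
    using assms by (auto simp: X)
  then show ?thesis by blast
qed

text \<open>The indices bound the size from above. Conversely, every stage contributes a point
  \<open>g a\<close> not built before, and these points are distinct.\<close>

lemma card_X: "|X| =o |L|"
proof -
  have "X \<subseteq> point P ` ((L \<times> UNIV) <+> UNIV)"
    using X_point by blast
  then have "|X| \<le>o |(L \<times> (UNIV :: real set)) <+> (UNIV :: nat set)|"
    by (rule ordLeq_transitive[OF card_of_mono1 card_of_image])
  then have le: "|X| \<le>o |L|"
    using card_index ordLeq_transitive by blast
  have "\<exists>x. x \<in> range (P a) \<and> x \<notin> built L P a" for a
    using stage[of a] by (auto simp: stage_def)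
  then obtain g where g: "\<And>a. g a \<in> range (P a)" "\<And>a. g a \<notin> built L P a"
    by metis
  have "g a \<noteq> g b" if "a \<in> underS |L| b" for a b
    using g(1)[of a] g(2)[of b] that by (auto simp: built_def)
  then have "inj_on g L"
    using strict_total_L by (metis inj_onI)
  moreover have "g a \<in> X" if "a \<in> L" for a
    using g(1)[of a] that by (auto simp: X)
  ultimately have "|L| \<le>o |X|"
    by (intro card_of_ordLeqI)
  with le show ?thesis
    by (simp add: ordIso_iff_ordLeq)
qed

text \<open>For the first stage at which a point with image \<^term>\<open>push level x\<close> appears, the point
  chosen by \<^const>\<open>avoid\<close> has not been built; it is banned from then on.\<close>

lemma missing_branch:
  assumes x: "x \<in> X - omega_pts"
  shows "\<exists>b. push (branch b) (push level x) \<notin> X"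
proof -
  have wf: "wf ( |L| - Id)"
    using card_of_well_order_on[of L] by (simp add: well_order_on_def)
  define p where "p = push level x"
  have p: "p \<in> omega_star"
    unfolding p_def using x X_subset by (intro push_level_free) (auto simp: omega_star_def)
  have "{a \<in> L. p \<in> push level ` range (P a)} \<noteq> {}"
    using x by (auto simp: X p_def)
  \<comment> \<open>The first stage with a point over \<open>p\<close>.\<close>
  then obtain a where a: "a \<in> L" "p \<in> push level ` range (P a)"
    and min: "\<And>b. (b, a) \<in> |L| - Id \<Longrightarrow> b \<notin> {a \<in> L. p \<in> push level ` range (P a)}"
    by (rule wfE_min'[OF wf]) blast
  obtain z where z: "z \<in> range (P a)" "p = push level z"
    using a(2) by blast
  define y where "y = avoid (range (P a)) p"
  have small: "|range (P a)| <o |UNIV :: real set|"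
    using stage[of a] mu_le_c ordLess_ordLeq_trans by (auto simp: stage_def)
  obtain b where y: "y \<notin> range (P a)" "y = push (branch b) p"
    using avoid[OF p small] unfolding y_def by blast
  have ly: "push level y = p"
    by (simp add: y(2) push_push)
  have not_pts: "w \<notin> omega_pts" if "push level w = p" for w
    using p that by (auto simp: omega_star_def omega_pts_def push_principal)
  have "y \<notin> range (P c)" if "c \<in> L" for c
    using wf that
  proof (induction c rule: wf_induct_rule)
    case (less c)
    have IH: "y \<notin> range (P d)" if "d \<in> underS |L| c" for d
    proof -
      have "d \<in> L"
        using that FieldI1[of d c "|L|"] by (simp add: underS_def Field_card_of)
      then show ?thesis
        using less.IH that by (simp add: underS_def)
    qed
    \<comment> \<open>At \<open>a\<close> itself \<open>avoid\<close> excludes \<open>y\<close>;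
      earlier stages have no point over \<open>p\<close>, whereas \<open>y\<close> lies over
      \<open>p\<close>; at later stages \<open>y\<close> is still not built by induction, hence
      banned.\<close>
    consider "c = a" | "c \<in> underS |L| a" | "a \<in> underS |L| c"
      using strict_total_L[OF less.prems a(1)] by blast
    then show ?case
    proof cases
      case 1
      then show ?thesis using y(1) by simp
    next
      case 2
      then show ?thesis
        using min[of c] less.prems ly by (fastforce simp: underS_def)
    next
      case 3
      have "y \<notin> built L P c"
        using IH not_pts[OF ly] by (auto simp: built_def)
      moreover have "y \<in> (\<lambda>x. avoid (range (P a)) (push level x)) ` (range (P a) - omega_pts)"
        using z not_pts[of z] by (auto simp: y_def)
      ultimately have "y \<in> banned L P c"
        using 3 by (auto simp: banned_def)
      then show ?thesis
        using stage[of c] by (auto simp: stage_def)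
    qed
  qed
  then have "y \<notin> X"
    using not_pts[OF ly] by (auto simp: X)
  then show ?thesis
    using y(2) by (auto simp: p_def)
qed

text \<open>The coded sequence mentions fewer than \<mu> stages, so by cofinality some stage bounds
  them all. Its task is scheduled again beyond that bound, and the stage \<open>a'\<close> treating
  it puts an accumulation point into the power of \<open>X\<close>.\<close>

lemma seq_acc_point_segment:
  assumes m: "m \<in> M" "infinite (underS |M| m)"
    and s: "\<And>n. s n \<in> topspace (product_topology (\<lambda>_. subtopology beta_omega_top X) (underS |M| m))"
  shows "\<exists>p. seq_acc_point (product_topology (\<lambda>_. subtopology beta_omega_top X) (underS |M| m)) s p"
proof -
  let ?K = "underS |M| m"
  let ?I = "(L \<times> (UNIV :: real set)) <+> (UNIV :: nat set)"
  have sX: "s n k \<in> X" if "k \<in> ?K" for n k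
    using s[of n] that by (auto simp: PiE_iff)
  obtain c where c: "\<And>x. x \<in> X \<Longrightarrow> c x \<in> ?I" "\<And>x. x \<in> X \<Longrightarrow> point P (c x) = x"
    using X_point by metis
  define t where "t = (\<lambda>(n, k)\<in>UNIV \<times> ?K. c (s n k))"
  have "t \<in> PiE (UNIV \<times> ?K) (\<lambda>_. ?I)"
    unfolding t_def by (rule restrict_PiE_iff[THEN iffD2]) (use c(1) sX in auto)
  then have task: "(m, t) \<in> tasks"
    using m(1) by (simp add: tasks_def)
  have tp: "point P (t (n, k)) = s n k" and tI: "t (n, k) \<in> ?I" if "k \<in> ?K" for n k
    using c sX[OF that] that by (auto simp: t_def)
  \<comment> \<open>The stages whose points occur in the sequence.\<close>
  define A where "A = {b. \<exists>n k i. k \<in> ?K \<and> t (n, k) = Inl (b, i)}"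
  have "A \<subseteq> L"
  proof
    fix b assume "b \<in> A"
    then obtain n k i where "k \<in> ?K" "t (n, k) = Inl (b, i)"
      by (auto simp: A_def)
    then show "b \<in> L"
      using tI[of k n] by auto
  qed
  have "A \<subseteq> (\<lambda>nk. fst (projl (t nk))) ` (UNIV \<times> ?K)"
  proof
    fix b assume "b \<in> A"
    then obtain n k i where "k \<in> ?K" "t (n, k) = Inl (b, i)"
      by (auto simp: A_def)
    then show "b \<in> (\<lambda>nk. fst (projl (t nk))) ` (UNIV \<times> ?K)"
      by (intro image_eqI[of _ _ "(n, k)"]) auto
  qed
  then have "|A| \<le>o |(UNIV :: nat set) \<times> ?K|"
    by (rule ordLeq_transitive[OF card_of_mono1 card_of_image])
  then have "|A| <o |M|"
    using card_nat_Times_less[OF card_of_underS_ordLess[OF infinite_M]] ordLeq_ordLess_trans by blast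
  then obtain a where a: "a \<in> L" "\<And>b. b \<in> A \<Longrightarrow> (b, a) \<in> |L|"
    using bounded_if_card_less_cofinality[OF \<open>A \<subseteq> L\<close> _ cf_lambda] by blast
  obtain a' where a': "a' \<in> L" "a \<in> underS |L| a'" "e a' = (m, t)"
    using e task a(1) by blast
  have "trans |L|" "antisym |L|"
    using card_of_well_order_on[of L] by (auto simp: order_on_defs)
  then have below: "b \<in> underS |L| a'" if "b \<in> A" for b
    using a(2)[OF that] a'(2) unfolding underS_def trans_def antisym_def by blast
  have "t (n, k) \<in> known L a'" if "k \<in> ?K" for n k
  proof (cases "t (n, k)")
    case (Inl bi)
    then have "fst bi \<in> A"
      using that unfolding A_def by (cases bi) auto
    then show ?thesis
      using below Inl by (auto simp: known_def mem_Times_iff)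
  qed (auto simp: known_def)
  moreover have "solves L P a' ?K t (P a')"
    using stage[of a'] a'(3) by (simp add: stage_def)
  ultimately have "seq_acc_point (product_topology (\<lambda>_. beta_omega_top) ?K)
      (\<lambda>n. \<lambda>k\<in>?K. point P (t (n, k))) (restrict (P a') ?K)"
    using m(2) by (simp add: solves_def)
  moreover have "(\<lambda>k\<in>?K. point P (t (n, k))) = s n" for n
  proof (rule extensionalityI[of _ ?K])
    show "s n \<in> extensional ?K"
      using s[of n] by (simp add: PiE_iff)
  qed (simp_all add: tp)
  ultimately have acc: "seq_acc_point (product_topology (\<lambda>_. beta_omega_top) ?K) s (restrict (P a') ?K)"
    by simp
  have "restrict (P a') ?K \<in> PiE ?K (\<lambda>_. X)"
    using a'(1) by (auto simp: X)
  moreover have "s n \<in> PiE ?K (\<lambda>_. X)" for n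
    using s[of n] by (auto simp: PiE_iff)
  ultimately show ?thesis
    using seq_acc_point_subtopology[OF acc, of "PiE ?K (\<lambda>_. X)"]
    unfolding subtopology_product_topology by blast
qed

text \<open>Tasks are solved only for infinite segments, so \<open>K\<close> is first enlarged by a
  copy of the naturals and then embedded into a segment of \<open>M\<close>.\<close>

lemma countably_compact_power:
  assumes "|K :: real set| <o |M|"
  shows "countably_compact_space (product_topology (\<lambda>_. subtopology beta_omega_top X) K)"
proof (rule countably_compact_if_seq_acc_point)
  fix s :: "nat \<Rightarrow> real \<Rightarrow> nat set set"
  assume s: "\<And>n. s n \<in> topspace (product_topology (\<lambda>_. subtopology beta_omega_top X) K)"
  have "|range real| <o |M|"
    using card_of_image omega1_le_mu by (rule ordLeq_ordLess_trans)
  then have "|K \<union> range real| <o |M|"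
    using assms infinite_M by (intro card_of_Un_ordLess_infinite)
  then obtain m where m: "m \<in> M" "|K \<union> range real| \<le>o |underS |M| m|"
    using ordLess_card_of_underS by blast
  then have inf: "infinite (underS |M| m)"
    using card_of_ordLeq_infinite[OF m(2)] infinite_real_image_nat by blast
  obtain h where "inj_on h (K \<union> range real)" "h ` (K \<union> range real) \<subseteq> underS |M| m"
    using m(2) card_of_ordLeq[of "K \<union> range real" "underS |M| m"] by blast
  then have "inj_on h K" "h ` K \<subseteq> underS |M| m"
    by (simp_all add: inj_on_Un image_Un)
  then show "\<exists>p. seq_acc_point (product_topology (\<lambda>_. subtopology beta_omega_top X) K) s p"
    by (rule seq_acc_point_power_transfer[OF _ _ seq_acc_point_segment[OF m(1) inf] s])
qed

end

lemma exists_space: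
  "\<exists>X. X \<subseteq> beta_omega \<and> omega_pts \<subseteq> X \<and> |X| =o |L| \<and>
       (\<forall>K :: real set. |K| <o |M| \<longrightarrow>
           countably_compact_space (product_topology (\<lambda>i. subtopology beta_omega_top X) K)) \<and>
       \<not> pseudocompact (vietoris (subtopology beta_omega_top X))"
proof -
  obtain e where e: "\<forall>\<tau>\<in>tasks. \<forall>a\<in>L. \<exists>a'\<in>L. a \<in> underS |L| a' \<and> e a' = \<tau>"
    using unbounded_enumeration[OF infinite_L card_tasks] by blast
  \<comment> \<open>The recursion runs over the whole type. Elements outside \<open>L\<close> have
    no predecessors, and \<open>?X\<close> collects only the stages in \<open>L\<close>.\<close>
  have "\<exists>P. \<forall>a. stage M L e P a (P a)"
  proof (rule dependent_wf_choice)
    show "wf ( |L| - Id)"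
      using card_of_well_order_on[of L] by (simp add: well_order_on_def)
    show "stage M L e P a R = stage M L e Q a R"
      if "\<And>b. (b, a) \<in> |L| - Id \<Longrightarrow> P b = Q b" for P Q a R
      by (rule stage_cong) (use that in \<open>simp add: underS_def\<close>)
    show "\<exists>R. stage M L e P a R"
      if "\<And>b. (b, a) \<in> |L| - Id \<Longrightarrow> stage M L e P b (P b)" for a P
    proof (rule stage_exists)
      fix b assume "b \<in> underS |L| a"
      then have "stage M L e P b (P b)"
        using that by (simp add: underS_def)
      then show "range (P b) \<subseteq> beta_omega \<and> |range (P b)| <o |M|"
        by (auto simp: stage_def)
    qed
  qed
  then obtain P where P: "\<And>a. stage M L e P a (P a)"
    by blast
  let ?X = "omega_pts \<union> (\<Union>a\<in>L. range (P a))"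
  note facts = e P refl[of ?X]
  show ?thesis
  proof (intro exI[of _ ?X] conjI allI impI)
    show "|?X| =o |L|"
      by (rule card_X[OF facts])
    show "?X \<subseteq> beta_omega"
      by (rule X_subset[OF facts])
    then show "\<not> pseudocompact (vietoris (subtopology beta_omega_top ?X))"
      by (rule not_pseudocompact_vietoris[OF _ _ missing_branch[OF facts]]) auto
    show "countably_compact_space (product_topology (\<lambda>i. subtopology beta_omega_top ?X) K)"
      if "|K| <o |M|" for K :: "real set"
      using countably_compact_power[OF facts that] .
  qed auto
qed

end

text \<open>The cardinals \<mu> and \<lambda> are represented by the sets \<open>M\<close> and
  \<open>L\<close>; the type of \<open>L\<close> expresses \<lambda> \<le> 2^\<c>. The bound on
  \<lambda>^{<\<mu>} is stated for each exponent separately, and cf(\<lambda>) \<ge> \<mu> as a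
  bound on all cofinal subsets.\<close>

theorem theorem2p2:
  fixes M :: "real set" and L :: "real set set"
  assumes omega1_le_mu: "|UNIV :: nat set| <o |M|"
    and mu_le_c: "|M| \<le>o |UNIV :: real set|"
    and c_le_lambda: "|UNIV :: real set| \<le>o |L|"
    and lambda_pow_less_mu: "\<forall>K :: real set. |K| <o |M| \<longrightarrow> |PiE K (\<lambda>_. L)| \<le>o |L|"
    and cf_lambda: "\<forall>A. A \<subseteq> L \<and> cofinal A |L| \<longrightarrow> |M| \<le>o |A|"
    and acc: "\<forall>(K :: real set) Y s. infinite K \<and> |K| <o |M| \<and>
               Y \<subseteq> omega_star \<and> |Y| <o |L| \<and>
               (\<forall>n. s n \<in> topspace (product_topology (\<lambda>i. subtopology beta_omega_top (beta_omega - Y)) K))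
               \<longrightarrow> (\<exists>p. seq_acc_point (product_topology (\<lambda>i. subtopology beta_omega_top (beta_omega - Y)) K) s p)"
  shows "\<exists>X. X \<subseteq> beta_omega \<and> omega_pts \<subseteq> X \<and> |X| =o |L| \<and>
           (\<forall>K :: real set. |K| <o |M| \<longrightarrow>
               countably_compact_space (product_topology (\<lambda>i. subtopology beta_omega_top X) K)) \<and>
           \<not> pseudocompact (vietoris (subtopology beta_omega_top X))"
proof -
  interpret accumulation M L
    by unfold_locales (use assms in blast)+
  show ?thesis
    by (rule exists_space)
qed

end
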